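(* Let $a$ and $b$ be real numbers with $a\neq 0,-1,-2,\dots$, $b\ne 0,-1,-2,\dots$, $a+b\neq 0,-1,-2,\dots$ and $ab<1$. Then the shifted zero-balanced hypergeometric function $z\,{}_2F_1(a,b;a+b;z)$ is not convex in $\mathbb D$.
   Context: $\mathbb D=\{z\in\mathbb C:|z|<1\}$. For real $a,b,c$ with $c\ne 0,-1,-2,\dots$, ${}_2F_1(a,b;c;z)=\sum_{n=0}^\infty \frac{(a)_n(b)_n}{(c)_n n!}z^n$ for $z\in\mathbb D$, where $(a)_0=1$ and $(a)_n=a(a+1)\cdots(a+n-1)$. A function $f$ analytic in $\mathbb D$ with $f(0)=0$, $f'(0)=1$ is called convex if it is univalent in $\mathbb D$ and $f(\mathbb D)$ is a convex domain; equivalently, $f'$ has no zeros in $\mathbb D$ and $1+\inf_{z\in\mathbb D}\operatorname{Re}\frac{zf''(z)}{f'(z)}\ge 0$. *)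

theory Defs
  imports "HOL-Complex_Analysis.Complex_Analysis"
begin

definition hypergeo_2F1 :: "real \<Rightarrow> real \<Rightarrow> real \<Rightarrow> complex \<Rightarrow> complex" where
  "hypergeo_2F1 a b c z =
     (\<Sum>n. of_real (pochhammer a n * pochhammer b n / (pochhammer c n * fact n)) * z ^ n)"

definition normalized_analytic :: "(complex \<Rightarrow> complex) \<Rightarrow> bool" where
  "normalized_analytic f \<longleftrightarrow> f holomorphic_on ball 0 1 \<and> f 0 = 0 \<and> deriv f 0 = 1"

text \<open>
  The image of the disc is required to be a convex domain.  Openness is not listed, since an
  injective holomorphic function is open; connectedness follows from convexity.
\<close>
definition convex_function :: "(complex \<Rightarrow> complex) \<Rightarrow> bool" where
  "convex_function f \<longleftrightarrow>
     normalized_analytic f \<and> inj_on f (ball 0 1) \<and> convex (f ` ball 0 1)"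

lemma hypergeo_2F1_eq_eval_fps:
  "hypergeo_2F1 a b c = eval_fps (fps_hypergeo [of_real a, of_real b] [of_real c] 1)"
  by (auto simp: fun_eq_iff hypergeo_2F1_def eval_fps_def pochhammer_of_real)

lemma hypergeo_2F1_conv_radius:
  fixes a b c :: real
  assumes "a \<notin> \<int>\<^sub>\<le>\<^sub>0" "b \<notin> \<int>\<^sub>\<le>\<^sub>0" "c \<notin> \<int>\<^sub>\<le>\<^sub>0"
  shows "fps_conv_radius (fps_hypergeo [of_real a, of_real b] [of_real c] (1::complex)) = 1"
proof -
  define C :: "nat \<Rightarrow> complex" where
    "C = (\<lambda>n. of_real (pochhammer a n * pochhammer b n / (pochhammer c n * fact n)))"
  have nz: "x + real n \<noteq> 0" if "x \<notin> \<int>\<^sub>\<le>\<^sub>0" for x n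
    using that plus_of_nat_eq_0_imp by blast
  have p: "pochhammer x n \<noteq> 0" if "x \<notin> \<int>\<^sub>\<le>\<^sub>0" for x :: real and n
    using that by (auto simp: pochhammer_eq_0_iff)
  have C0: "C n \<noteq> 0" for n
    using p[OF assms(1)] p[OF assms(2)] p[OF assms(3)] by (simp add: C_def)
  have ratio: "norm (C n) / norm (C (Suc n)) =
      \<bar>(c + real n) * (1 + real n) / ((a + real n) * (b + real n))\<bar>" for n
    using p[OF assms(1)] p[OF assms(2)] p[OF assms(3)]
      nz[OF assms(1)] nz[OF assms(2)] nz[OF assms(3)]
    unfolding C_def norm_of_real abs_divide[symmetric] by (simp add: pochhammer_Suc divide_simps)
  have "(\<lambda>n. \<bar>(c + real n) * (1 + real n) / ((a + real n) * (b + real n))\<bar>) \<longlonglongrightarrow> \<bar>1\<bar>"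
    by (intro tendsto_rabs) real_asymp
  hence "(\<lambda>n. ereal (norm (C n) / norm (C (Suc n)))) \<longlonglongrightarrow> 1"
    by (simp add: ratio one_ereal_def)
  hence "conv_radius C = 1"
    using C0 by (intro conv_radius_ratio_limit_ereal) auto
  moreover have "fps_nth (fps_hypergeo [of_real a, of_real b] [of_real c] (1::complex)) = C"
    by (auto simp: fun_eq_iff C_def pochhammer_of_real)
  ultimately show ?thesis by (simp add: fps_conv_radius_def)
qed

text \<open>
  So non-convexity of the shifted zero-balanced function never comes from a failure of the
  normalization.
\<close>
lemma normalized_analytic_shifted_hypergeo_2F1:
  fixes a b c :: real
  assumes "a \<notin> \<int>\<^sub>\<le>\<^sub>0" "b \<notin> \<int>\<^sub>\<le>\<^sub>0" "c \<notin> \<int>\<^sub>\<le>\<^sub>0"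
  shows "normalized_analytic (\<lambda>z. z * hypergeo_2F1 a b c z)"
proof -
  have hol: "hypergeo_2F1 a b c holomorphic_on ball 0 1"
    unfolding hypergeo_2F1_eq_eval_fps
    by (rule holomorphic_on_subset[OF holomorphic_on_eval_fps[OF order_refl]])
       (simp add: hypergeo_2F1_conv_radius[OF assms] one_ereal_def)
  have F0: "hypergeo_2F1 a b c 0 = 1"
    by (simp add: hypergeo_2F1_eq_eval_fps eval_fps_at_0)
  have "hypergeo_2F1 a b c field_differentiable at 0"
    using hol by (rule holomorphic_on_imp_differentiable_at) auto
  hence "deriv (\<lambda>z. z * hypergeo_2F1 a b c z) 0 = 1"
    by (simp add: F0)
  with hol show ?thesis
    unfolding normalized_analytic_def by (auto intro!: holomorphic_intros)
qed

end

theory Submission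
  imports Defs
begin

text \<open>
  Write \<open>f z = z * F(a, b; a + b; z)\<close> and \<open>p z = 1 + z * f'' z / f' z\<close>.  Convexity of the image forces
  \<open>Re p \<ge> 0\<close> on the disc (\<open>convex_image_imp_Re_nonneg\<close>), and a function with nonnegative real part
  cannot fall below the Poisson kernel of the point mass that it carries at \<open>1\<close>: by Harnack's
  inequality \<open>Re (p r) * (1 - r) / (1 + r)\<close> decreases in \<open>r\<close>, so if it tends to \<open>\<beta>\<close> then
  \<open>Re (p r) \<ge> \<beta> * (1 + r) / (1 - r)\<close> (\<open>Re_ge_boundary_mass\<close>).

  The zero-balanced function has a logarithmic singularity at \<open>1\<close>, with \<open>f' z\<close> close to \<open>A / (1 - z)\<close>.
  In terms of coefficients, \<open>f' z = (\<Sum>n. c n * z ^ n)\<close> where \<open>c n\<close> tends to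
  \<open>A = \<Gamma>(a + b) / (\<Gamma>(a) * \<Gamma>(b)) \<noteq> 0\<close>.  Hence \<open>p r\<close> is \<open>1 / (1 - r)\<close> to leading order, the mass is
  \<open>\<beta> = 1/2\<close>, and Harnack's bound says that \<open>p r - 1 / (1 - r) \<ge> - 1/2\<close>.  This difference is,
  up to a factor that tends to \<open>1\<close>, the logarithmic derivative of \<open>h r = (1 - r) * f' r\<close>.  The
  differences \<open>c (n + 1) - c n\<close> behave like \<open>A * (a * b - 1) / n\<^sup>2\<close>, so \<open>h' r\<close> is comparable to the
  harmonic series and \<open>h' r / h r\<close> tends to \<open>- \<infinity>\<close> when \<open>a * b < 1\<close>, a contradiction.
\<close>

section \<open>Convex images and the real part of the curvature expression\<close>

lemma has_real_derivative_Re_of_real: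
  assumes "(F has_field_derivative F') (at (of_real x))"
  shows "((\<lambda>x. Re (F (of_real x))) has_real_derivative Re F') (at x)"
  using bounded_linear.has_vector_derivative[OF bounded_linear_Re has_vector_derivative_real_field[OF assms]]
  by (simp add: has_real_derivative_iff_has_vector_derivative)

text \<open>
  For \<open>0 \<le> t \<le> 1\<close> convexity puts \<open>(1 - t) * f w + t * f (u * w)\<close> into the image, so it equals \<open>f (\<omega> w)\<close>
  for a self-map \<open>\<omega>\<close> of the disc that fixes \<open>0\<close>.  By the Schwarz lemma \<open>\<omega>\<close> does not move \<open>z\<close> outwards;
  at \<open>t = 0\<close> it is the identity, and the sign of its \<open>t\<close>-derivative there is the claim.
\<close>
lemma convex_image_two_point:
  assumes hol: "f holomorphic_on ball 0 1" and inj: "inj_on f (ball 0 1)"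
    and conv: "convex (f ` ball 0 1)"
    and z: "norm z < 1" and u: "norm u \<le> 1"
  shows "Re (cnj z * ((f (u * z) - f z) / deriv f z)) \<le> 0"
proof -
  define D where "D = ball (0::complex) 1"
  have openD: "open (f ` D)"
    unfolding D_def by (rule open_mapping_thm3[OF hol _ inj]) auto
  obtain k where k: "k holomorphic_on f ` D"
      and dk: "\<And>x. x \<in> D \<Longrightarrow> deriv f x * deriv k (f x) = 1"
      and kf: "\<And>x. x \<in> D \<Longrightarrow> k (f x) = x"
    using holomorphic_has_inverse[OF hol _ inj] by (auto simp: D_def)
  have uw: "u * w \<in> D" if "w \<in> D" for w
    using that u mult_left_le_one_le[of "norm w" "norm u"] by (auto simp: D_def norm_mult)
  have bound: "norm (k ((1 - t) *\<^sub>R f z + t *\<^sub>R f (u * z))) \<le> norm z" if t: "0 \<le> t" "t \<le> 1" for t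
  proof -
    define \<omega> where "\<omega> = (\<lambda>w. k ((1 - t) *\<^sub>R f w + t *\<^sub>R f (u * w)))"
    have im: "(1 - t) *\<^sub>R f w + t *\<^sub>R f (u * w) \<in> f ` D" if "w \<in> D" for w
      using convexD[OF conv, of "f w" "f (u * w)" "1 - t" t] t that uw[OF that]
      by (auto simp: D_def)
    have h1: "(\<lambda>w. f (u * w)) holomorphic_on D"
      using holomorphic_on_compose_gen[of "\<lambda>w. u * w" D f D] hol uw
      by (auto simp: o_def D_def image_subset_iff intro!: holomorphic_intros)
    have "(\<lambda>w. (1 - t) *\<^sub>R f w + t *\<^sub>R f (u * w)) holomorphic_on D"
      using h1 hol unfolding scaleR_conv_of_real D_def by (intro holomorphic_intros)
    from holomorphic_on_compose_gen[OF this k] have "\<omega> holomorphic_on ball 0 1"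
      using im by (simp add: \<omega>_def o_def D_def image_subset_iff)
    moreover have "\<omega> 0 = 0"
      using kf[of 0] by (simp add: \<omega>_def D_def flip: scaleR_left.add)
    moreover have "norm (\<omega> w) < 1" if w: "norm w < 1" for w
    proof -
      obtain y where "y \<in> D" "(1 - t) *\<^sub>R f w + t *\<^sub>R f (u * w) = f y"
        using im[of w] w by (auto simp: D_def)
      thus ?thesis using kf[of y] by (simp add: \<omega>_def D_def)
    qed
    ultimately show ?thesis
      using Schwarz_Lemma(1)[of \<omega> z] z by (simp add: \<omega>_def)
  qed
  \<comment> \<open>Pairing with \<open>cnj z\<close> makes the outward displacement linear in \<open>k\<close>; on \<open>[0, 1)\<close> it is largest at \<open>0\<close>.\<close>
  define \<psi> where "\<psi> = (\<lambda>t::real. Re (cnj z * k (f z + of_real t * (f (u * z) - f z))))"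
  have zD: "z \<in> D" using z by (simp add: D_def)
  define m where "m = Re (cnj z * ((f (u * z) - f z) / deriv f z))"
  have "(k has_field_derivative deriv k (f z)) (at (f z))"
    using holomorphic_derivI[OF k openD] zD by auto
  moreover have "deriv k (f z) = 1 / deriv f z"
    using dk[OF zD] by (metis div_by_0 divide_self_if mult_zero_left nonzero_eq_divide_eq mult.commute)
  ultimately have "((\<lambda>t. cnj z * k (f z + t * (f (u * z) - f z))) has_field_derivative
      cnj z * ((f (u * z) - f z) / deriv f z)) (at (of_real 0))"
    by (auto intro!: derivative_eq_intros DERIV_chain2[where f = k])
  hence d: "(\<psi> has_real_derivative m) (at 0)"
    unfolding \<psi>_def m_def
    using has_real_derivative_Re_of_real by fastforce
  have le: "\<psi> t \<le> \<psi> 0" if "0 < t" "t < 1" for t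
  proof -
    have "\<psi> t \<le> norm z * norm (k ((1 - t) *\<^sub>R f z + t *\<^sub>R f (u * z)))"
      unfolding \<psi>_def by (rule order.trans[OF complex_Re_le_cmod])
         (simp add: norm_mult scaleR_conv_of_real algebra_simps)
    also have "\<dots> \<le> norm z * norm z"
      using bound[of t] that by (intro mult_left_mono) auto
    also have "\<dots> = \<psi> 0"
      by (simp add: \<psi>_def kf[OF zD] complex_mult_cnj cmod_def power2_eq_square flip: power2_eq_square)
    finally show ?thesis .
  qed
  have "\<not> m > 0"
  proof
    assume "m > 0"
    with d obtain d where "d > 0" and inc: "\<And>h. h > 0 \<Longrightarrow> h < d \<Longrightarrow> \<psi> 0 < \<psi> (0 + h)"
      using DERIV_pos_inc_right by metis
    then obtain h where "0 < h" "h < min d 1"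
      using dense[of 0 "min d 1"] by auto
    with inc[of h] le[of h] show False by simp
  qed
  thus ?thesis by (simp add: m_def)
qed

lemma second_derivative_nonpos_at_max:
  fixes \<phi> \<phi>' :: "real \<Rightarrow> real"
  assumes d: "\<And>x. (\<phi> has_real_derivative \<phi>' x) (at x)"
    and d2: "(\<phi>' has_real_derivative s) (at a)"
    and z: "\<phi>' a = 0" and max: "\<And>x. \<phi> x \<le> \<phi> a"
  shows "s \<le> 0"
proof (rule ccontr)
  assume "\<not> s \<le> 0"
  then obtain d where d0: "d > 0" and pos: "\<And>h. 0 < h \<Longrightarrow> h < d \<Longrightarrow> \<phi>' a < \<phi>' (a + h)"
    using DERIV_pos_inc_right[OF d2] by auto
  have "\<phi> a < \<phi> (a + d / 2)"
  proof (rule DERIV_pos_imp_increasing_open[of a "a + d / 2" \<phi>])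
    fix x assume "a < x" "x < a + d / 2"
    thus "\<exists>y. (\<phi> has_real_derivative y) (at x) \<and> 0 < y"
      using d[of x] pos[of "x - a"] z by auto
  qed (use d0 d in \<open>auto intro!: continuous_at_imp_continuous_on intro: DERIV_isCont\<close>)
  with max[of "a + d / 2"] show False by simp
qed

text \<open>
  With \<open>u = exp (\<i> * x)\<close> the two-point inequality says that \<open>Re (f (exp (\<i> * x) * z) / (z * deriv f z))\<close>
  is largest at \<open>x = 0\<close>.  Its second derivative there is the negative of the quantity in question.
\<close>
lemma convex_image_imp_Re_nonneg:
  assumes hol: "f holomorphic_on ball 0 1" and inj: "inj_on f (ball 0 1)"
    and conv: "convex (f ` ball 0 1)" and z: "norm z < 1"
  shows "Re (1 + z * deriv (deriv f) z / deriv f z) \<ge> 0"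
proof (cases "z = 0")
  case False
  have nz: "deriv f z \<noteq> 0"
    using holomorphic_injective_imp_regular[OF hol _ inj] z by auto
  define G where "G = (\<lambda>x. f (exp (\<i> * x) * z) / (z * deriv f z))"
  define G' where "G' = (\<lambda>x. \<i> * exp (\<i> * x) * deriv f (exp (\<i> * x) * z) / deriv f z)"
  have circ: "norm (exp (\<i> * of_real x) * z) < 1" for x
    using z by (simp add: norm_mult)
  have df: "(f has_field_derivative deriv f w) (at w)" if "norm w < 1" for w
    using holomorphic_derivI[OF hol] that by auto
  have hol': "deriv f holomorphic_on ball 0 1"
    using hol by (intro holomorphic_deriv) auto
  have ddf: "(deriv f has_field_derivative deriv (deriv f) w) (at w)" if "norm w < 1" for w
    using holomorphic_derivI[OF hol'] that by auto
  have G: "(G has_field_derivative G' (of_real x)) (at (of_real x))" for x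
    unfolding G_def G'_def using df[OF circ[of x]] False nz
    by (auto intro!: derivative_eq_intros DERIV_chain2[where f = f])
  have G2: "(G' has_field_derivative - (1 + z * deriv (deriv f) z / deriv f z)) (at (of_real 0))"
    unfolding G'_def using ddf[OF z] nz
    by (auto intro!: derivative_eq_intros DERIV_chain2[where f = "deriv f"] simp: field_simps)
  have "Re (- (1 + z * deriv (deriv f) z / deriv f z)) \<le> 0"
  proof (rule second_derivative_nonpos_at_max)
    show "((\<lambda>x. Re (G (of_real x))) has_real_derivative Re (G' (of_real x))) (at x)" for x
      using G[of x] by (rule has_real_derivative_Re_of_real)
    show "((\<lambda>x. Re (G' (of_real x))) has_real_derivative
        Re (- (1 + z * deriv (deriv f) z / deriv f z))) (at 0)"
      using G2 by (rule has_real_derivative_Re_of_real)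
    show "Re (G' (of_real 0)) = 0" by (simp add: G'_def nz)
    fix x :: real
    have "cnj z * ((f (exp (\<i> * of_real x) * z) - f z) / deriv f z) =
        of_real ((norm z)\<^sup>2) * (G (of_real x) - G (of_real 0))"
      using False nz unfolding G_def complex_norm_square by (simp add: divide_simps)
    hence "(norm z)\<^sup>2 * Re (G (of_real x) - G (of_real 0)) \<le> 0"
      using convex_image_two_point[OF hol inj conv z, of "exp (\<i> * of_real x)"]
      by (simp del: of_real_power)
    thus "Re (G (of_real x)) \<le> Re (G (of_real 0))"
      using False by (simp add: mult_le_0_iff)
  qed
  thus ?thesis by simp
qed auto

section \<open>Harnack's inequality along a radius\<close>

text \<open>
  The Cayley transform based at \<open>P 0\<close> carries the right half-plane to the disc and \<open>P 0\<close> to \<open>0\<close>, so the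
  Schwarz lemma bounds the transform of \<open>P z\<close> by the norm of \<open>z\<close>.  Adding \<open>e > 0\<close> to \<open>P\<close> keeps the values
  strictly inside the half-plane, as the Schwarz lemma requires; then \<open>e\<close> tends to \<open>0\<close>.
\<close>
lemma Harnack_upper:
  assumes hol: "P holomorphic_on ball 0 1"
    and nonneg: "\<And>z. norm z < 1 \<Longrightarrow> 0 \<le> Re (P z)" and z: "norm z < 1"
  shows "Re (P z) * (1 - norm z) \<le> Re (P 0) * (1 + norm z)"
proof -
  have shifted: "(Re (P z) + e) * (1 - norm z) \<le> (Re (P 0) + e) * (1 + norm z)" if e: "e > 0" for e
  proof -
    define Q where "Q = (\<lambda>w. P w + of_real e)"
    define \<omega> where "\<omega> = (\<lambda>w. (Q w - Q 0) / (Q w + cnj (Q 0)))"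
    have pos: "Re (Q w) > 0" if "norm w < 1" for w
      using nonneg[OF that] e by (simp add: Q_def)
    have nz: "Q w + cnj (Q 0) \<noteq> 0" if "norm w < 1" for w
      using pos[OF that] pos[of 0] by (auto simp: complex_eq_iff)
    have "\<omega> holomorphic_on ball 0 1"
      unfolding \<omega>_def Q_def using hol nz by (auto intro!: holomorphic_intros simp: Q_def)
    moreover have "norm (\<omega> w) < 1" if w: "norm w < 1" for w
    proof -
      have "(norm (Q w - Q 0))\<^sup>2 < (norm (Q w + cnj (Q 0)))\<^sup>2"
        using mult_pos_pos[OF pos[OF w] pos[of 0]] unfolding cmod_power2
        by (simp add: power2_eq_square algebra_simps)
      hence "norm (Q w - Q 0) < norm (Q w + cnj (Q 0))"
        by (rule power2_less_imp_less) simp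
      thus ?thesis by (simp add: \<omega>_def norm_divide divide_less_eq_1)
    qed
    ultimately have "norm (\<omega> z) \<le> norm z"
      using Schwarz_Lemma(1)[of \<omega> z] z by (simp add: \<omega>_def)
    hence "norm (Q z - Q 0) \<le> norm z * norm (Q z + cnj (Q 0))"
      using nz[OF z] by (simp add: \<omega>_def norm_divide divide_le_eq)
    hence "(norm (Q z - Q 0))\<^sup>2 \<le> (norm z * norm (Q z + cnj (Q 0)))\<^sup>2"
      by (rule power_mono) simp
    hence "(Re (Q z) - Re (Q 0))\<^sup>2 + (Im (Q z) - Im (Q 0))\<^sup>2
        \<le> (norm z)\<^sup>2 * ((Re (Q z) + Re (Q 0))\<^sup>2 + (Im (Q z) - Im (Q 0))\<^sup>2)"
      unfolding power_mult_distrib cmod_power2 by simp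
    moreover have "(norm z)\<^sup>2 * (Im (Q z) - Im (Q 0))\<^sup>2 \<le> (Im (Q z) - Im (Q 0))\<^sup>2"
      using z by (intro mult_left_le_one_le) (auto simp: power_le_one)
    ultimately have "(Re (Q z) - Re (Q 0))\<^sup>2 \<le> (norm z * (Re (Q z) + Re (Q 0)))\<^sup>2"
      unfolding power_mult_distrib distrib_left[of "(norm z)\<^sup>2"] by linarith
    moreover have "0 \<le> norm z * (Re (Q z) + Re (Q 0))"
      using pos[OF z] pos[of 0] by auto
    ultimately have "Re (Q z) - Re (Q 0) \<le> norm z * (Re (Q z) + Re (Q 0))"
      by (rule power2_le_imp_le)
    thus ?thesis by (simp add: Q_def algebra_simps)
  qed
  have "eventually (\<lambda>e. (Re (P z) + e) * (1 - norm z) \<le> (Re (P 0) + e) * (1 + norm z)) (at_right 0)"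
    using shifted by (auto simp: eventually_at_filter)
  moreover have "((\<lambda>e. (Re (P z) + e) * (1 - norm z)) \<longlongrightarrow> (Re (P z) + 0) * (1 - norm z)) (at_right 0)"
    by (intro tendsto_intros)
  moreover have "((\<lambda>e. (Re (P 0) + e) * (1 + norm z)) \<longlongrightarrow> (Re (P 0) + 0) * (1 + norm z)) (at_right 0)"
    by (intro tendsto_intros)
  ultimately have "(Re (P z) + 0) * (1 - norm z) \<le> (Re (P 0) + 0) * (1 + norm z)"
    by (intro tendsto_le[OF trivial_limit_at_right_real])
  thus ?thesis by simp
qed

text \<open>
  Harnack's inequality, recentred at \<open>r\<close>: a disc automorphism takes \<open>0\<close> to \<open>r\<close> and some \<open>t\<close> to \<open>s\<close>, and
  the ratio \<open>(1 + t) / (1 - t)\<close> is the quotient of the ratios for \<open>s\<close> and \<open>r\<close>.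
\<close>
lemma Harnack_radial_antimono:
  assumes hol: "P holomorphic_on ball 0 1"
    and nonneg: "\<And>z. norm z < 1 \<Longrightarrow> 0 \<le> Re (P z)" and r: "0 \<le> r" "r \<le> s" "s < 1"
  shows "Re (P (of_real s)) * ((1 - s) / (1 + s)) \<le> Re (P (of_real r)) * ((1 - r) / (1 + r))"
proof -
  define M where "M = Moebius_function 0 (- of_real r)"
  have nr: "norm (- of_real r :: complex) < 1" using r by simp
  have Mball: "norm (M z) < 1" if "norm z < 1" for z
    unfolding M_def using Moebius_function_norm_lt_1[OF nr that] .
  have "(\<lambda>z. P (M z)) holomorphic_on ball 0 1"
    using holomorphic_on_compose_gen[OF Moebius_function_holomorphic[OF nr, of 0] hol] Mball
    by (auto simp: o_def M_def image_subset_iff)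
  define t where "t = (s - r) / (1 - r * s)"
  have rs: "r * s < 1" using r mult_left_le_one_le[of s r] by linarith
  have t0: "0 \<le> t" using r rs by (simp add: t_def)
  have t1: "1 - t = (1 - s) * (1 + r) / (1 - r * s)" "1 + t = (1 + s) * (1 - r) / (1 - r * s)"
    using rs by (simp_all add: t_def field_simps)
  have "(1 - s) * (1 + r) / (1 - r * s) > 0" using r rs by simp
  hence tl: "t < 1" using t1(1) by linarith
  have rt: "1 + r * t > 0" using r t0 by (simp add: add_pos_nonneg)
  have "(t + r) / (1 + r * t) = s"
  proof -
    have "t * (1 - r * s) = s - r" using rs by (simp add: t_def)
    thus ?thesis using rt by (simp add: field_simps)
  qed
  moreover have "M (of_real t) = of_real ((t + r) / (1 + r * t))"
    by (simp add: M_def Moebius_function_def)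
  ultimately have Mt: "M (of_real t) = of_real s" by simp
  have "Re (P (M (of_real t))) * (1 - norm (of_real t :: complex)) \<le>
        Re (P (M 0)) * (1 + norm (of_real t :: complex))"
    by (rule Harnack_upper) (use \<open>(\<lambda>z. P (M z)) holomorphic_on ball 0 1\<close> nonneg Mball t0 tl in auto)
  hence "Re (P (of_real s)) * (1 - t) \<le> Re (P (of_real r)) * (1 + t)"
    unfolding Mt using t0 by (simp add: M_def Moebius_function_def)
  hence "Re (P (of_real s)) * ((1 - s) * (1 + r)) \<le> Re (P (of_real r)) * ((1 + s) * (1 - r))"
    using rs unfolding t1 by (simp add: divide_right_mono_neg divide_le_cancel)
  hence "Re (P (of_real s)) * ((1 - s) * (1 + r)) / ((1 + s) * (1 + r)) \<le>
      Re (P (of_real r)) * ((1 + s) * (1 - r)) / ((1 + s) * (1 + r))"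
    using r by (intro divide_right_mono) auto
  thus ?thesis using r by simp
qed

text \<open>
  The limit \<open>\<beta>\<close> is the mass at \<open>1\<close> of the Herglotz measure of \<open>P\<close>, and \<open>(1 + r) / (1 - r)\<close> is the Poisson
  kernel of that point.
\<close>
lemma Re_ge_boundary_mass:
  assumes hol: "P holomorphic_on ball 0 1"
    and nonneg: "\<And>z. norm z < 1 \<Longrightarrow> 0 \<le> Re (P z)"
    and lim: "((\<lambda>s. Re (P (of_real s)) * ((1 - s) / (1 + s))) \<longlongrightarrow> \<beta>) (at_left 1)"
    and r: "0 \<le> r" "r < 1"
  shows "\<beta> * ((1 + r) / (1 - r)) \<le> Re (P (of_real r))"
proof -
  have "eventually (\<lambda>s. s \<in> {r<..<1}) (at_left 1)"
    using r by (intro eventually_at_left_real)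
  hence "eventually (\<lambda>s. Re (P (of_real s)) * ((1 - s) / (1 + s)) \<le>
      Re (P (of_real r)) * ((1 - r) / (1 + r))) (at_left 1)"
    by eventually_elim (rule Harnack_radial_antimono[OF hol nonneg], use r in auto)
  hence "\<beta> \<le> Re (P (of_real r)) * ((1 - r) / (1 + r))"
    using tendsto_upperbound[OF lim] by simp
  thus ?thesis using r by (simp add: field_simps)
qed

section \<open>Power series at the boundary point 1\<close>

lemma summable_powser_bounded_coeffs:
  fixes u :: "nat \<Rightarrow> 'a :: {real_normed_field, banach}"
  assumes "Bseq u" "norm z < 1"
  shows "summable (\<lambda>n. u n * z ^ n)"
proof -
  obtain K where K: "\<And>n. norm (u n) \<le> K" using assms(1) by (auto simp: Bseq_def)
  show ?thesis
  proof (rule summable_comparison_test')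
    show "summable (\<lambda>n. K * norm z ^ n)"
      using assms(2) by (intro summable_mult summable_geometric) auto
    show "norm (u n * z ^ n) \<le> K * norm z ^ n" for n
      using K by (simp add: norm_mult norm_power mult_right_mono)
  qed
qed

text \<open>
  The weights \<open>(1 - r) * r ^ n\<close> sum to \<open>1\<close>, and the weight of every fixed initial segment vanishes as
  \<open>r\<close> tends to \<open>1\<close>.
\<close>
lemma Abel_mean_tendsto:
  fixes u :: "nat \<Rightarrow> real"
  assumes "u \<longlonglongrightarrow> L"
  shows "((\<lambda>r. (1 - r) * (\<Sum>n. u n * r ^ n)) \<longlongrightarrow> L) (at_left 1)"
proof -
  have main: "eventually (\<lambda>r. \<bar>(1 - r) * (\<Sum>n. u n * r ^ n) - L\<bar> < e) (at_left 1)" if e: "e > 0" for e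
  proof -
    from LIMSEQ_D[OF assms, of "e / 2"] e obtain N where N: "\<And>n. n \<ge> N \<Longrightarrow> \<bar>u n - L\<bar> < e / 2"
      by auto
    define S where "S = (\<Sum>n<N. \<bar>u n - L\<bar>)"
    have "((\<lambda>r. (1 - r) * S + e / 2) \<longlongrightarrow> (1 - 1) * S + e / 2) (at_left 1)"
      by (intro tendsto_intros)
    hence "eventually (\<lambda>r. (1 - r) * S + e / 2 < e) (at_left 1)"
      by (rule order_tendstoD) (use e in simp)
    moreover have "eventually (\<lambda>r::real. r \<in> {0<..<1}) (at_left 1)"
      by (intro eventually_at_left_real) auto
    ultimately show ?thesis
    proof eventually_elim
      case (elim r)
      have B: "Bseq u" "Bseq (\<lambda>n. \<bar>u n - L\<bar>)"
        using assms by (auto intro!: convergent_imp_Bseq convergentI tendsto_intros)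
      have r1: "norm r < 1" using elim by auto
      note sm = summable_powser_bounded_coeffs[OF _ r1]
      have geo: "(\<lambda>n. L * r ^ n) sums (L * (1 / (1 - r)))"
        using r1 by (intro sums_mult geometric_sums) auto
      have "(1 - r) * (\<Sum>n. u n * r ^ n) - L = (1 - r) * ((\<Sum>n. u n * r ^ n) - (\<Sum>n. L * r ^ n))"
        using elim sums_unique[OF geo] by (simp add: field_simps)
      also have "(\<Sum>n. u n * r ^ n) - (\<Sum>n. L * r ^ n) = (\<Sum>n. (u n - L) * r ^ n)"
        using suminf_diff[OF sm[OF B(1)] sums_summable[OF geo]] by (simp add: algebra_simps)
      also have "\<bar>(1 - r) * (\<Sum>n. (u n - L) * r ^ n)\<bar> = (1 - r) * \<bar>\<Sum>n. (u n - L) * r ^ n\<bar>"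
        using elim by (simp add: abs_mult)
      also have "\<dots> \<le> (1 - r) * (\<Sum>n. \<bar>u n - L\<bar> * r ^ n)"
        using elim summable_rabs[of "\<lambda>n. (u n - L) * r ^ n"] sm[OF B(2)]
        by (intro mult_left_mono) (auto simp: abs_mult)
      also have "(\<Sum>n. \<bar>u n - L\<bar> * r ^ n) = (\<Sum>n. \<bar>u (n + N) - L\<bar> * r ^ (n + N)) + (\<Sum>n<N. \<bar>u n - L\<bar> * r ^ n)"
        by (rule suminf_split_initial_segment[OF sm[OF B(2)]])
      also have "(\<Sum>n<N. \<bar>u n - L\<bar> * r ^ n) \<le> S"
        unfolding S_def using elim by (intro sum_mono mult_right_le_one_le) (auto intro: power_le_one)
      also have "(\<Sum>n. \<bar>u (n + N) - L\<bar> * r ^ (n + N)) \<le> (\<Sum>n. e / 2 * r ^ n)"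
      proof (rule suminf_le)
        show "summable (\<lambda>n. \<bar>u (n + N) - L\<bar> * r ^ (n + N))"
          using sm[OF B(2)] by (rule summable_ignore_initial_segment)
        show "summable (\<lambda>n. e / 2 * r ^ n)"
          using r1 by (intro summable_mult summable_geometric) auto
        show "\<bar>u (n + N) - L\<bar> * r ^ (n + N) \<le> e / 2 * r ^ n" for n
          using N[of "n + N"] elim e by (intro mult_mono power_decreasing) auto
      qed
      also have "(\<Sum>n. e / 2 * r ^ n) = e / 2 * (1 / (1 - r))"
        using r1 by (subst suminf_mult) (auto simp: suminf_geometric)
      finally have "\<bar>(1 - r) * (\<Sum>n. u n * r ^ n) - L\<bar> \<le> (1 - r) * (e / 2 * (1 / (1 - r)) + S)"
        using elim by simp
      also have "\<dots> = (1 - r) * S + e / 2" using elim by (simp add: field_simps)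
      finally show ?case using elim by simp
    qed
  qed
  show ?thesis using main by (simp add: tendsto_iff dist_real_def)
qed

text \<open>
  Once the terms are nonnegative, a long partial sum bounds the series from below, and a partial sum is
  continuous in \<open>r\<close>.
\<close>
lemma powser_at_top_at_left_1:
  fixes u :: "nat \<Rightarrow> real"
  assumes pos: "eventually (\<lambda>n. u n \<ge> 0) sequentially"
    and sum: "\<And>r. 0 < r \<Longrightarrow> r < 1 \<Longrightarrow> summable (\<lambda>n. u n * r ^ n)"
    and div: "\<not> summable u"
  shows "filterlim (\<lambda>r. \<Sum>n. u n * r ^ n) at_top (at_left 1)"
proof (rule filterlim_at_top_gt[where c = 0, THEN iffD2], intro allI impI)
  fix Z :: real
  assume "Z > 0"
  obtain N where N: "\<And>n. n \<ge> N \<Longrightarrow> u n \<ge> 0" using pos by (auto simp: eventually_sequentially)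
  have "\<exists>M\<ge>N. (\<Sum>n<M. u n) > Z"
  proof (rule ccontr)
    assume "\<not> (\<exists>M\<ge>N. (\<Sum>n<M. u n) > Z)"
    hence le: "(\<Sum>n<M. u n) \<le> Z" if "M \<ge> N" for M using that by (meson not_le)
    have "summable (\<lambda>n. u (n + N))"
    proof (rule summableI_nonneg_bounded)
      show "(\<Sum>n<m. u (n + N)) \<le> Z - (\<Sum>n<N. u n)" for m
        using le[of "m + N"] sum.shift_bounds_nat_ivl[of u 0 N m]
          sum.atLeastLessThan_concat[of 0 N "m + N" u]
        by (simp add: lessThan_atLeast0)
    qed (use N in auto)
    with div show False by (simp add: summable_iff_shift)
  qed
  then obtain M where M: "M \<ge> N" "(\<Sum>n<M. u n) > Z" by blast
  have "((\<lambda>r. \<Sum>n<M. u n * r ^ n) \<longlongrightarrow> (\<Sum>n<M. u n * 1 ^ n)) (at_left 1)"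
    by (intro tendsto_intros)
  hence "eventually (\<lambda>r. (\<Sum>n<M. u n * r ^ n) > Z) (at_left 1)"
    by (rule order_tendstoD) (use M in simp)
  moreover have "eventually (\<lambda>r::real. r \<in> {0<..<1}) (at_left 1)"
    by (intro eventually_at_left_real) auto
  ultimately show "eventually (\<lambda>r. Z \<le> (\<Sum>n. u n * r ^ n)) (at_left 1)"
  proof eventually_elim
    case (elim r)
    have "(\<Sum>n<M. u n * r ^ n) \<le> (\<Sum>n. u n * r ^ n)"
      using elim N M by (intro sum_le_suminf sum) auto
    with elim show ?case by simp
  qed
qed

lemma fps_conv_radius_bounded_coeffs:
  fixes u :: "nat \<Rightarrow> 'a :: {real_normed_field, banach}"
  assumes "Bseq u"
  shows "fps_conv_radius (Abs_fps u) \<ge> 1"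
  unfolding fps_conv_radius_def
proof (rule conv_radius_geI_ex')
  fix r :: real assume "0 < r" "ereal r < 1"
  thus "summable (\<lambda>n. fps_nth (Abs_fps u) n * of_real r ^ n)"
    using summable_powser_bounded_coeffs[OF assms, of "of_real r"] by (simp add: one_ereal_def)
qed

lemma eval_fps_of_real_coeffs:
  fixes G :: "real fps" and K :: "'a :: {real_normed_field, banach} fps"
  assumes "ereal \<bar>x\<bar> < fps_conv_radius G" and "\<And>n. fps_nth K n = of_real (fps_nth G n)"
  shows "eval_fps K (of_real x) = of_real (eval_fps G x)"
proof -
  have "(\<lambda>n. of_real (fps_nth G n * x ^ n) :: 'a) sums of_real (eval_fps G x)"
    using assms(1) by (intro sums_of_real sums_eval_fps) simp
  thus ?thesis
    unfolding eval_fps_def by (simp add: assms(2) sums_iff)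
qed

text \<open>
  If \<open>h\<close> has coefficients \<open>c\<close>, then \<open>E\<close> is the series of the derivative of \<open>(1 - x) * h x\<close>.  The identity
  is the logarithmic derivative of the product \<open>1 / (1 - x) * ((1 - x) * h x)\<close>, which splits off
  \<open>1 / (1 - x)\<close>, the leading term at \<open>1\<close> when \<open>c\<close> converges to a nonzero limit.
\<close>
lemma powser_log_derivative_real_axis:
  fixes c :: "nat \<Rightarrow> real"
  defines "g \<equiv> \<lambda>x. \<Sum>n. c n * x ^ n"
    and "E \<equiv> \<lambda>x. \<Sum>n. real (Suc n) * (c (Suc n) - c n) * x ^ n"
  assumes bdd: "Bseq c" and x: "0 \<le> x" "x < 1" and nz: "g x \<noteq> 0"
    and h: "\<And>z. norm z < 1 \<Longrightarrow> h z = (\<Sum>n. of_real (c n) * z ^ n)"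
  shows "Re (1 + of_real x * deriv h (of_real x) / h (of_real x)) =
    1 / (1 - x) + x * E x / ((1 - x) * g x)"
proof -
  define G where "G = Abs_fps c"
  define K where "K = Abs_fps (\<lambda>n. complex_of_real (c n))"
  have radG: "fps_conv_radius G \<ge> 1"
    unfolding G_def by (rule fps_conv_radius_bounded_coeffs[OF bdd])
  have radK: "fps_conv_radius K \<ge> 1"
    unfolding K_def using bdd by (intro fps_conv_radius_bounded_coeffs) (simp add: Bseq_def)
  have small: "ereal (norm w) < R" if "norm w < 1" "1 \<le> R" for w :: "'b :: real_normed_vector" and R
    using that less_le_trans[of "ereal (norm w)" 1 R] by simp
  have x1: "ereal (norm (of_real x :: complex)) < fps_conv_radius K"
    "ereal (norm x) < fps_conv_radius G" "ereal (norm x) < fps_conv_radius (fps_deriv G)"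
    using x radK radG order.trans[OF radG fps_conv_radius_deriv] by (intro small; simp)+
  have "h (of_real x) = eval_fps K (of_real x)"
    using h[of "of_real x"] x by (simp add: eval_fps_def K_def)
  also have "\<dots> = of_real (g x)"
    using eval_fps_of_real_coeffs[of x G K] x1(2) by (simp add: K_def G_def g_def eval_fps_def)
  finally have hx: "h (of_real x) = of_real (g x)" .
  have "deriv h (of_real x) = deriv (eval_fps K) (of_real x)"
  proof (rule deriv_cong_ev)
    have "eventually (\<lambda>z. z \<in> ball 0 1) (nhds (complex_of_real x))"
      using x by (intro eventually_nhds_in_open) auto
    thus "eventually (\<lambda>z. h z = eval_fps K z) (nhds (complex_of_real x))"
      by eventually_elim (simp add: h eval_fps_def K_def)
  qed auto
  also have "\<dots> = eval_fps (fps_deriv K) (of_real x)"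
    using x1(1) by (rule eval_fps_deriv[symmetric])
  also have "\<dots> = of_real (eval_fps (fps_deriv G) x)"
    using eval_fps_of_real_coeffs[of x "fps_deriv G" "fps_deriv K"] x1(3) by (simp add: K_def G_def)
  finally have dhx: "deriv h (of_real x) = of_real (eval_fps (fps_deriv G) x)" .
  have "E x = (1 - x) * eval_fps (fps_deriv G) x - g x"
  proof -
    have s1: "(\<lambda>n. real (Suc n) * c (Suc n) * x ^ n) sums eval_fps (fps_deriv G) x"
      using sums_eval_fps[OF x1(3)] by (simp add: G_def)
    have s2: "(\<lambda>n. c n * x ^ n) sums g x"
      using sums_eval_fps[OF x1(2)] by (simp add: G_def g_def eval_fps_def)
    have "(\<lambda>n. real n * c n * x ^ n) sums (x * eval_fps (fps_deriv G) x)"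
      using sums_mult[OF s1, of x] sums_Suc_iff[of "\<lambda>n. real n * c n * x ^ n"]
      by (simp add: mult_ac)
    from sums_diff[OF sums_diff[OF s1 this] s2] show ?thesis
      by (simp add: E_def sums_iff algebra_simps)
  qed
  hence "eval_fps (fps_deriv G) x = (E x + g x) / (1 - x)"
    using x by (simp add: field_simps)
  hence "x * eval_fps (fps_deriv G) x / g x = x * E x / ((1 - x) * g x) + x / (1 - x)"
    using nz by (simp add: add_divide_distrib distrib_left)
  moreover have "1 + x / (1 - x) = 1 / (1 - x)"
    using x by (simp add: field_simps)
  ultimately have "1 + x * eval_fps (fps_deriv G) x / g x = 1 / (1 - x) + x * E x / ((1 - x) * g x)"
    by linarith
  thus ?thesis
    by (simp add: hx dhx flip: of_real_mult of_real_divide)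
qed

section \<open>A coefficient condition for convexity\<close>

text \<open>
  Suppose \<open>\<kappa> < 0\<close>.  The coefficients \<open>e n\<close> of the derivative of \<open>(1 - x) * f' x\<close> tend to \<open>0\<close>, so by Abel
  means the boundary mass at \<open>1\<close> is exactly \<open>1/2\<close>, and Harnack's bound keeps the term with \<open>E\<close> from
  falling below \<open>- 1/2\<close>.  But \<open>e n / A\<close> behaves like \<open>\<kappa> / n\<close>, and the divergence of the harmonic series drives that
  term to \<open>- \<infinity>\<close>.
\<close>
lemma convex_imp_coeff_defect_nonneg:
  fixes c :: "nat \<Rightarrow> real"
  assumes cf: "convex_function f"
    and der: "\<And>z. norm z < 1 \<Longrightarrow> deriv f z = (\<Sum>n. of_real (c n) * z ^ n)"
    and A: "c \<longlonglongrightarrow> A" "A \<noteq> 0"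
    and defect: "(\<lambda>n. (real (Suc n))\<^sup>2 * (c (Suc n) - c n)) \<longlonglongrightarrow> A * \<kappa>"
  shows "\<kappa> \<ge> 0"
proof (rule ccontr)
  assume "\<not> \<kappa> \<ge> 0"
  hence \<kappa>: "\<kappa> < 0" by simp
  have hol: "f holomorphic_on ball 0 1" and inj: "inj_on f (ball 0 1)" and conv: "convex (f ` ball 0 1)"
    using cf by (auto simp: convex_function_def normalized_analytic_def)
  define e where "e = (\<lambda>n. real (Suc n) * (c (Suc n) - c n))"
  define g where "g = (\<lambda>x. \<Sum>n. c n * x ^ n)"
  define E where "E = (\<lambda>x. \<Sum>n. e n * x ^ n)"
  define P where "P = (\<lambda>z. 1 + z * deriv (deriv f) z / deriv f z)"
  have nz: "deriv f z \<noteq> 0" if "norm z < 1" for z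
    using holomorphic_injective_imp_regular[OF hol _ inj] that by auto
  have holP: "P holomorphic_on ball 0 1"
    unfolding P_def using hol nz by (auto intro!: holomorphic_intros)
  have Ppos: "Re (P z) \<ge> 0" if "norm z < 1" for z
    unfolding P_def using convex_image_imp_Re_nonneg[OF hol inj conv that] .
  have bdd: "Bseq c" using A by (auto intro: convergent_imp_Bseq convergentI)
  have rn: "(\<lambda>n. inverse (real (Suc n))) \<longlonglongrightarrow> 0" by (rule LIMSEQ_inverse_real_of_nat)
  have e0: "e \<longlonglongrightarrow> 0"
  proof -
    have "(\<lambda>n. inverse (real (Suc n)) * ((real (Suc n))\<^sup>2 * (c (Suc n) - c n))) \<longlonglongrightarrow> 0 * (A * \<kappa>)"
      by (intro tendsto_mult rn defect)
    moreover have "inverse (real (Suc n)) * ((real (Suc n))\<^sup>2 * (c (Suc n) - c n)) = e n" for n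
      by (simp add: e_def power2_eq_square del: of_nat_Suc)
    ultimately show ?thesis by simp
  qed
  have ge: "((\<lambda>x. (1 - x) * g x) \<longlongrightarrow> A) (at_left 1)" "((\<lambda>x. (1 - x) * E x) \<longlongrightarrow> 0) (at_left 1)"
    unfolding g_def E_def by (intro Abel_mean_tendsto A e0)+
  have ev: "eventually (\<lambda>x::real. x \<in> {0<..<1}) (at_left 1)"
    by (intro eventually_at_left_real) auto
  have xx: "((\<lambda>x::real. x) \<longlongrightarrow> 1) (at_left 1)" by (intro tendsto_intros)
  have Pr: "Re (P (of_real x)) = 1 / (1 - x) + x * E x / ((1 - x) * g x)" if "0 \<le> x" "x < 1" for x
  proof -
    have "deriv f (of_real x) = of_real (g x)"
      using der[of "of_real x"] that summable_powser_bounded_coeffs[OF bdd, of x]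
      by (simp add: g_def suminf_of_real)
    hence "g x \<noteq> 0" using nz[of "of_real x"] that by auto
    thus ?thesis
      unfolding P_def E_def e_def g_def
      using powser_log_derivative_real_axis[OF bdd that, of "deriv f"] der by simp
  qed

  have "((\<lambda>x. (1 + x * ((1 - x) * E x) / ((1 - x) * g x)) / (1 + x)) \<longlongrightarrow> (1 + 1 * 0 / A) / (1 + 1)) (at_left 1)"
    by (intro tendsto_intros ge xx A) auto
  moreover have "(1 + 1 * 0 / A) / (1 + 1) = 1 / 2" by simp
  ultimately have "((\<lambda>x. (1 + x * ((1 - x) * E x) / ((1 - x) * g x)) / (1 + x)) \<longlongrightarrow> 1 / 2) (at_left 1)"
    by (simp only:)
  hence mass: "((\<lambda>x. Re (P (of_real x)) * ((1 - x) / (1 + x))) \<longlongrightarrow> 1 / 2) (at_left 1)"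
  proof (rule Lim_transform_eventually)
    show "eventually (\<lambda>x. (1 + x * ((1 - x) * E x) / ((1 - x) * g x)) / (1 + x) =
        Re (P (of_real x)) * ((1 - x) / (1 + x))) (at_left 1)"
      using ev
    proof eventually_elim
      case (elim x)
      hence "Re (P (of_real x)) * (1 - x) = 1 + x * ((1 - x) * E x) / ((1 - x) * g x)"
        using Pr[of x] by (simp add: distrib_right)
      thus ?case by simp
    qed
  qed
  have lower: "- 1 / 2 \<le> x * E x / ((1 - x) * g x)" if x: "0 < x" "x < 1" for x
  proof -
    have "1 / 2 * ((1 + x) / (1 - x)) \<le> 1 / (1 - x) + x * E x / ((1 - x) * g x)"
      using Re_ge_boundary_mass[OF holP Ppos mass, of x] Pr[of x] x by simp
    moreover have "1 / 2 * ((1 + x) / (1 - x)) = 1 / (1 - x) - 1 / 2"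
      using x by (simp add: field_simps)
    ultimately show ?thesis by linarith
  qed

  \<comment> \<open>Dividing by \<open>- A\<close> makes the coefficients eventually positive, whatever the sign of \<open>A\<close>.\<close>
  have defect': "(\<lambda>n. real (Suc n) * (- e n / A)) \<longlonglongrightarrow> - \<kappa>"
    using tendsto_divide[OF tendsto_minus[OF defect] tendsto_const A(2)] A(2)
    by (simp add: e_def power2_eq_square mult_ac del: of_nat_Suc)
  have big: "eventually (\<lambda>n. real (Suc n) * (- e n / A) > - \<kappa> / 2) sequentially"
    using order_tendstoD(1)[OF defect', of "- \<kappa> / 2"] \<kappa> by simp
  have blow: "filterlim (\<lambda>x. \<Sum>n. - e n / A * x ^ n) at_top (at_left 1)"
  proof (rule powser_at_top_at_left_1)
    show "eventually (\<lambda>n. 0 \<le> - e n / A) sequentially"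
      using big
    proof eventually_elim
      case (elim n)
      hence "0 < real (Suc n) * (- e n / A)" using \<kappa> by linarith
      thus ?case by (simp only: zero_less_mult_iff) auto
    qed
    have "Bseq (\<lambda>n. - e n / A)"
      using tendsto_divide[OF tendsto_minus[OF e0] tendsto_const A(2)]
      by (intro convergent_imp_Bseq convergentI)
    thus "summable (\<lambda>n. - e n / A * r ^ n)" if "0 < r" "r < 1" for r
      using that by (intro summable_powser_bounded_coeffs) auto
    show "\<not> summable (\<lambda>n. - e n / A)"
    proof
      assume "summable (\<lambda>n. - e n / A)"
      hence "summable (\<lambda>n. - \<kappa> / 2 * inverse (real (Suc n)))"
      proof (rule summable_comparison_test_ev[rotated])
        show "eventually (\<lambda>n. norm (- \<kappa> / 2 * inverse (real (Suc n))) \<le> - e n / A) sequentially"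
          using big
        proof eventually_elim
          case (elim n)
          thus ?case using \<kappa> by (simp add: field_simps del: of_nat_Suc)
        qed
      qed
      hence "summable (\<lambda>n. inverse (real (Suc n)))"
        using \<kappa> by (subst (asm) summable_cmult_iff) auto
      thus False
        using not_summable_harmonic[where 'a = real] summable_Suc_iff[of "\<lambda>n. inverse (real n)"] by blast
    qed
  qed
  have lim1: "((\<lambda>x. x * A / ((1 - x) * g x)) \<longlongrightarrow> 1 * A / A) (at_left 1)"
    by (intro tendsto_intros ge xx A)
  have "filterlim (\<lambda>x. x * A / ((1 - x) * g x) * (\<Sum>n. - e n / A * x ^ n)) at_top (at_left 1)"
    using A(2) by (intro filterlim_tendsto_pos_mult_at_top[OF lim1 _ blow]) auto
  hence "eventually (\<lambda>x. x * A / ((1 - x) * g x) * (\<Sum>n. - e n / A * x ^ n) > 1 / 2) (at_left 1)"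
    unfolding filterlim_at_top_dense by (rule spec)
  with ev have "eventually (\<lambda>x::real. False) (at_left 1)"
  proof eventually_elim
    case (elim x)
    have "Bseq e" using e0 by (auto intro: convergent_imp_Bseq convergentI)
    hence "(\<Sum>n. (- 1 / A) * (e n * x ^ n)) = (- 1 / A) * E x"
      unfolding E_def using elim by (intro suminf_mult summable_powser_bounded_coeffs) auto
    hence "(\<Sum>n. - e n / A * x ^ n) = - E x / A" by simp
    hence "1 / 2 < - (x * E x / ((1 - x) * g x))" using elim A(2) by simp
    with lower[of x] elim show ?case by simp
  qed
  thus False by simp
qed

section \<open>The zero-balanced hypergeometric function\<close>

text \<open>
  Three Gauss products for the Gamma function.  Because the third parameter is \<open>a + b\<close>, the powers of
  \<open>n\<close> in them cancel; the index shift contributes the factor \<open>1 + 1 / (n + 1)\<close>.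
\<close>
lemma zero_balanced_coeff_tendsto:
  fixes a b :: real
  assumes "a + b \<notin> \<int>\<^sub>\<le>\<^sub>0"
  shows "(\<lambda>n. real (Suc n) * (pochhammer a n * pochhammer b n / (pochhammer (a + b) n * fact n)))
    \<longlonglongrightarrow> rGamma a * rGamma b / rGamma (a + b)"
proof -
  have "(\<lambda>n. (1 + 1 / real (Suc n)) * (rGamma_series a n * rGamma_series b n / rGamma_series (a + b) n))
      \<longlonglongrightarrow> (1 + 0) * (rGamma a * rGamma b / rGamma (a + b))"
    using assms LIMSEQ_inverse_real_of_nat
    by (intro tendsto_intros rGamma_series_LIMSEQ) (auto simp: rGamma_eq_zero_iff inverse_eq_divide)
  moreover have "(1 + 1 / real (Suc n)) * (rGamma_series a n * rGamma_series b n / rGamma_series (a + b) n)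
     = real (Suc (Suc n)) * (pochhammer a (Suc n) * pochhammer b (Suc n) / (pochhammer (a + b) (Suc n) * fact (Suc n)))" for n
  proof -
    have "1 + 1 / real (Suc n) = real (Suc (Suc n)) / real (Suc n)"
      by (simp add: field_simps)
    note ratio = this
    show ?thesis
      unfolding ratio rGamma_series_def by (simp add: distrib_right exp_add mult_ac del: of_nat_Suc)
  qed
  ultimately show ?thesis
    by (subst filterlim_sequentially_Suc[symmetric]) simp
qed

text \<open>
  The ratio of consecutive coefficients is \<open>(n + 2) * (a + n) * (b + n) / ((a + b + n) * (n + 1)\<^sup>2)\<close>.  In
  its difference from \<open>1\<close> the cubic and quadratic terms of the numerator cancel, and the linear one
  has the factor \<open>a * b - 1\<close>, which is where the condition on \<open>a * b\<close> comes from.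
\<close>
lemma zero_balanced_coeff_defect:
  fixes a b :: real and c
  defines "c \<equiv> \<lambda>n. real (Suc n) * (pochhammer a n * pochhammer b n / (pochhammer (a + b) n * fact n))"
  assumes "a + b \<notin> \<int>\<^sub>\<le>\<^sub>0"
  shows "(real (Suc n))\<^sup>2 * (c (Suc n) - c n) =
    c n * (((a * b - 1) * real n + 2 * a * b - (a + b)) / (real n + (a + b)))"
proof -
  have nz: "real n + (a + b) \<noteq> 0"
    using assms(2) plus_of_nat_eq_0_imp[of "a + b" n] by (auto simp: add_ac)
  have cancel: "M * (u * y * (v * z) / (w * s * (N * q))) * N\<^sup>2 = N * (u * v / (w * q)) * (M * y * z / s)"
    if "N \<noteq> 0" for M N u v w q y z s :: real
    using that by (simp add: power2_eq_square mult_ac)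
  have "c (Suc n) * (real (Suc n))\<^sup>2 = c n * ((real n + 2) * (a + n) * (b + n) / (real n + (a + b)))"
    using cancel[of "real (Suc n)" "real n + 2"] unfolding c_def pochhammer_Suc fact_Suc
    by (simp add: add_ac)
  hence "(real (Suc n))\<^sup>2 * (c (Suc n) - c n) =
      c n * ((real n + 2) * (a + n) * (b + n) / (real n + (a + b)) - (real (Suc n))\<^sup>2)"
    by (simp add: algebra_simps)
  also have "(real n + 2) * (a + n) * (b + n) / (real n + (a + b)) - (real (Suc n))\<^sup>2 =
      ((a * b - 1) * real n + 2 * a * b - (a + b)) / (real n + (a + b))"
    using nz by (simp add: field_simps power2_eq_square)
  finally show ?thesis .
qed

theorem corollary1p2:
  fixes a b :: real
  assumes "a \<notin> \<int>\<^sub>\<le>\<^sub>0"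
    and "b \<notin> \<int>\<^sub>\<le>\<^sub>0"
    and "a + b \<notin> \<int>\<^sub>\<le>\<^sub>0"
    and "a * b < 1"
  shows "\<not> convex_function (\<lambda>z. z * hypergeo_2F1 a b (a + b) z)"
proof
  assume conv: "convex_function (\<lambda>z. z * hypergeo_2F1 a b (a + b) z)"
  define c where
    "c = (\<lambda>n. real (Suc n) * (pochhammer a n * pochhammer b n / (pochhammer (a + b) n * fact n)))"
  define A where "A = rGamma a * rGamma b / rGamma (a + b)"
  have A: "c \<longlonglongrightarrow> A" "A \<noteq> 0"
    using zero_balanced_coeff_tendsto[OF assms(3)] assms by (auto simp: c_def A_def rGamma_eq_zero_iff)
  have "(\<lambda>n. ((a * b - 1) * real n + 2 * a * b - (a + b)) / (real n + (a + b))) \<longlonglongrightarrow> a * b - 1"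
    by real_asymp
  hence defect: "(\<lambda>n. (real (Suc n))\<^sup>2 * (c (Suc n) - c n)) \<longlonglongrightarrow> A * (a * b - 1)"
    unfolding c_def zero_balanced_coeff_defect[OF assms(3)]
    by (intro tendsto_mult) (use A in \<open>auto simp: c_def\<close>)
  define F :: "complex fps" where "F = fps_hypergeo [of_real a, of_real b] [of_real (a + b)] 1"
  have F: "hypergeo_2F1 a b (a + b) = eval_fps F"
    by (simp add: hypergeo_2F1_eq_eval_fps F_def)
  have rad: "fps_conv_radius F = 1"
    unfolding F_def by (rule hypergeo_2F1_conv_radius[OF assms(1-3)])
  have "deriv (\<lambda>z. z * hypergeo_2F1 a b (a + b) z) z = (\<Sum>n. of_real (c n) * z ^ n)" if z: "norm z < 1" for z
  proof -
    have radXF: "fps_conv_radius (fps_X * F) \<ge> 1"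
      using fps_conv_radius_mult[of fps_X F] by (simp add: rad)
    have z': "ereal (norm z) < fps_conv_radius (fps_X * F)"
      using z radXF less_le_trans[of "ereal (norm z)" 1] by simp
    have "deriv (\<lambda>z. z * hypergeo_2F1 a b (a + b) z) z = deriv (eval_fps (fps_X * F)) z"
    proof (rule deriv_cong_ev)
      have "eventually (\<lambda>w. w \<in> ball 0 1) (nhds z)"
        using z by (intro eventually_nhds_in_open) auto
      thus "eventually (\<lambda>w. w * hypergeo_2F1 a b (a + b) w = eval_fps (fps_X * F) w) (nhds z)"
        by eventually_elim (auto simp: eval_fps_mult rad F)
    qed auto
    also have "\<dots> = eval_fps (fps_deriv (fps_X * F)) z"
      using z' by (rule eval_fps_deriv[symmetric])
    also have "\<dots> = (\<Sum>n. of_real (c n) * z ^ n)"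
    proof -
      have "pochhammer (of_real a + of_real b) n = complex_of_real (pochhammer (a + b) n)" for n
        by (simp flip: pochhammer_of_real)
      hence "fps_nth (fps_deriv (fps_X * F)) n = of_real (c n)" for n
        unfolding fps_deriv_nth by (simp add: F_def c_def pochhammer_of_real)
      thus ?thesis by (simp add: eval_fps_def)
    qed
    finally show ?thesis .
  qed
  from convex_imp_coeff_defect_nonneg[OF conv this A defect] show False
    using assms(4) by simp
qed

end
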